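(* Let $n\ge 1$. The set $BO(n)=\{(X,Y)\in GL(n)\times GL(n) : XY=I\}$ is an $n^2$-dimensional submanifold of the $2n^2$-dimensional product manifold $\mathcal{G}(n)=GL(n)\times GL(n)$.
   Context: $M(n)=\mathbb{R}^{n\times n}$ is the space of real $n\times n$ matrices. $GL(n)$ is the general linear group of invertible real $n\times n$ matrices, regarded as an $n^2$-dimensional (open) submanifold of $M(n)$. $I$ is the $n\times n$ identity matrix. $\mathcal{G}(n)=GL(n)\times GL(n)$ carries the product manifold structure. $BO(n)$ is called the biorthogonal manifold. *)

theory Defs
  imports "HOL-Analysis.Analysis"
begin

section \<open>Smooth maps on open subsets of Euclidean spaces\<close>

text \<open>On open sets of finite-dimensional spaces, class \<open>C\<^sup>k\<close> is continuity of all
  iterated directional derivatives up to order \<open>k\<close>. Both notions are meant for open \<open>S\<close>.\<close>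

primrec Ck_on :: "nat \<Rightarrow> 'a::euclidean_space set \<Rightarrow> ('a \<Rightarrow> 'b::euclidean_space) \<Rightarrow> bool" where
  "Ck_on 0 S f \<longleftrightarrow> continuous_on S f"
| "Ck_on (Suc k) S f \<longleftrightarrow>
     (\<forall>x\<in>S. f differentiable (at x)) \<and> (\<forall>v. Ck_on k S (\<lambda>x. frechet_derivative f (at x) v))"

definition smooth_on :: "'a::euclidean_space set \<Rightarrow> ('a \<Rightarrow> 'b::euclidean_space) \<Rightarrow> bool" where
  "smooth_on S f \<longleftrightarrow> (\<forall>k. Ck_on k S f)"

section \<open>Smooth manifolds\<close>

text \<open>A chart is a pair of a domain and a map; the values of the map outside the domain are
  irrelevant. The manifold is modelled on the Euclidean space \<open>'e\<close>.\<close>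

type_synonym ('a, 'e) chart = "'a set \<times> ('a \<Rightarrow> 'e)"

definition is_chart :: "'a topology \<Rightarrow> ('a, 'e::euclidean_space) chart \<Rightarrow> bool" where
  "is_chart T c \<longleftrightarrow> (case c of (U, \<phi>) \<Rightarrow>
     openin T U \<and> open (\<phi> ` U) \<and>
     homeomorphic_map (subtopology T U) (top_of_set (\<phi> ` U)) \<phi>)"

definition compatible :: "('a, 'e::euclidean_space) chart \<Rightarrow> ('a, 'e) chart \<Rightarrow> bool" where
  "compatible c d \<longleftrightarrow> (case c of (U, \<phi>) \<Rightarrow> case d of (V, \<psi>) \<Rightarrow>
     smooth_on (\<phi> ` (U \<inter> V)) (\<psi> \<circ> inv_into U \<phi>) \<and>
     smooth_on (\<psi> ` (U \<inter> V)) (\<phi> \<circ> inv_into V \<psi>))"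

record ('a, 'e) manifold =
  mtop :: "'a topology"
  atlas :: "('a, 'e) chart set"

definition smooth_manifold :: "('a, 'e::euclidean_space) manifold \<Rightarrow> bool" where
  "smooth_manifold M \<longleftrightarrow>
     Hausdorff_space (mtop M) \<and> second_countable (mtop M) \<and>
     (\<forall>c\<in>atlas M. is_chart (mtop M) c) \<and>
     (\<Union>c\<in>atlas M. fst c) = topspace (mtop M) \<and>
     (\<forall>c\<in>atlas M. \<forall>d\<in>atlas M. compatible c d)"

definition mdim :: "('a, 'e::euclidean_space) manifold \<Rightarrow> nat" where
  "mdim M = DIM('e)"

definition maximal_atlas :: "('a, 'e::euclidean_space) manifold \<Rightarrow> ('a, 'e) chart set" where
  "maximal_atlas M = {c. is_chart (mtop M) c \<and> (\<forall>d\<in>atlas M. compatible c d)}"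

definition euclidean_manifold :: "('e::euclidean_space, 'e) manifold" where
  "euclidean_manifold = \<lparr>mtop = euclidean, atlas = {(UNIV, id)}\<rparr>"

text \<open>Intended for \<open>S\<close> open in \<open>M\<close>.\<close>

definition open_submanifold ::
    "('a, 'e::euclidean_space) manifold \<Rightarrow> 'a set \<Rightarrow> ('a, 'e) manifold" where
  "open_submanifold M S =
     \<lparr>mtop = subtopology (mtop M) S, atlas = {(U \<inter> S, \<phi>) | U \<phi>. (U, \<phi>) \<in> atlas M}\<rparr>"

definition product_manifold ::
    "('a, 'e::euclidean_space) manifold \<Rightarrow> ('b, 'f::euclidean_space) manifold \<Rightarrow>
     ('a \<times> 'b, 'e \<times> 'f) manifold" where
  "product_manifold M N =
     \<lparr>mtop = prod_topology (mtop M) (mtop N),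
      atlas = {(U \<times> V, map_prod \<phi> \<psi>) | U \<phi> V \<psi>. (U, \<phi>) \<in> atlas M \<and> (V, \<psi>) \<in> atlas N}\<rparr>"

text \<open>\<open>k\<close>-dimensional (embedded, smooth) submanifold: around each of its points, \<open>S\<close> is cut out
  by a \<open>k\<close>-dimensional linear slice in some chart of the smooth structure of \<open>M\<close>.\<close>

definition submanifold :: "nat \<Rightarrow> 'a set \<Rightarrow> ('a, 'e::euclidean_space) manifold \<Rightarrow> bool" where
  "submanifold k S M \<longleftrightarrow>
     S \<subseteq> topspace (mtop M) \<and>
     (\<forall>p\<in>S. \<exists>U \<phi> V. (U, \<phi>) \<in> maximal_atlas M \<and> p \<in> U \<and>
        subspace V \<and> dim V = k \<and> \<phi> ` (U \<inter> S) = \<phi> ` U \<inter> V)"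

section \<open>The biorthogonal manifold\<close>

definition GL :: "(real ^ 'n ^ 'n) set" where
  "GL = {A. invertible A}"

definition GL_manifold :: "(real ^ 'n ^ 'n, real ^ 'n ^ 'n) manifold" where
  "GL_manifold = open_submanifold euclidean_manifold GL"

definition G_manifold ::
    "((real ^ 'n ^ 'n) \<times> (real ^ 'n ^ 'n), (real ^ 'n ^ 'n) \<times> (real ^ 'n ^ 'n)) manifold" where
  "G_manifold = product_manifold GL_manifold GL_manifold"

definition BO :: "((real ^ 'n ^ 'n) \<times> (real ^ 'n ^ 'n)) set" where
  "BO = {(X, Y). X \<in> GL \<and> Y \<in> GL \<and> X ** Y = mat 1}"

end

theory Submission
  imports Defs
begin

text \<open>On the open set \<open>GL \<times> GL\<close> the map \<open>(X, Y) \<mapsto> (X, XY - I)\<close> is a single chart that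
  flattens all of \<open>BO\<close> to the slice \<open>M(n) \<times> {0}\<close>. Its inverse \<open>(X, Z) \<mapsto> (X, X\<^sup>-\<^sup>1(Z + I))\<close>
  is smooth because matrix inversion is: inversion is continuous by Cramer's rule, and
  its derivative \<open>H \<mapsto> - A\<^sup>-\<^sup>1 H A\<^sup>-\<^sup>1\<close> is polynomial in the inverse itself, so each order of
  differentiability yields the next.\<close>

section \<open>Closure properties of smooth maps\<close>

lemma Ck_on_Suc_has_derivative:
  "Ck_on (Suc k) S f \<Longrightarrow> x \<in> S \<Longrightarrow> (f has_derivative frechet_derivative f (at x)) (at x)"
  by (simp add: frechet_derivative_works[symmetric])

lemma Ck_on_frechet_derivative:
  "Ck_on (Suc k) S f \<Longrightarrow> Ck_on k S (\<lambda>x. frechet_derivative f (at x) v)"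
  by simp

text \<open>Agreement on an open set is agreement near each point, so the derivatives there agree
  too and the induction applies to them. This is what lets an explicit inverse replace
  \<open>inv_into\<close> in chart changes.\<close>

lemma Ck_on_cong:
  assumes "open S" "\<And>x. x \<in> S \<Longrightarrow> f x = g x" "Ck_on k S f"
  shows "Ck_on k S g"
  using assms(2,3)
proof (induction k arbitrary: f g)
  case 0
  then show ?case by (metis Ck_on.simps(1) continuous_on_cong)
next
  case (Suc k)
  have D: "(g has_derivative frechet_derivative f (at x)) (at x)" if "x \<in> S" for x
    using has_derivative_transform_within_open[OF Ck_on_Suc_has_derivative[OF Suc.prems(2) that] assms(1) that]
      Suc.prems(1) by blast
  have "Ck_on k S (\<lambda>x. frechet_derivative g (at x) v)" for v
    by (rule Suc.IH[OF _ Ck_on_frechet_derivative[OF Suc.prems(2)]])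
      (simp add: frechet_derivative_at[OF D])
  then show ?case using D by (auto simp: differentiable_def)
qed

text \<open>Uniqueness of derivatives replaces the choice made by \<open>frechet_derivative\<close>
  with an explicit formula \<open>f'\<close>; the inductions below all go through this rule.\<close>

lemma Ck_on_SucI:
  assumes "open S" "\<And>x. x \<in> S \<Longrightarrow> (f has_derivative f' x) (at x)"
    and "\<And>v. Ck_on k S (\<lambda>x. f' x v)"
  shows "Ck_on (Suc k) S f"
proof -
  have "Ck_on k S (\<lambda>x. frechet_derivative f (at x) v)" for v
    by (rule Ck_on_cong[OF assms(1) _ assms(3)]) (simp add: frechet_derivative_at[OF assms(2)])
  then show ?thesis using assms(2) by (auto simp: differentiable_def)
qed

text \<open>The product rule differentiates one factor and keeps the other, whose order must then be
  lowered. At the bottom, differentiability gives continuity.\<close>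

lemma Ck_on_SucD: "Ck_on (Suc k) S f \<Longrightarrow> Ck_on k S f"
proof (induction k arbitrary: f)
  case 0
  then show ?case
    by (simp add: continuous_at_imp_continuous_on differentiable_imp_continuous_within)
next
  case (Suc k)
  then show ?case by (metis Ck_on.simps(2))
qed

lemma smooth_on_has_derivative:
  "smooth_on S f \<Longrightarrow> x \<in> S \<Longrightarrow> (f has_derivative frechet_derivative f (at x)) (at x)"
  unfolding smooth_on_def using Ck_on_Suc_has_derivative by blast

lemma Ck_on_const: "Ck_on k S (\<lambda>x. c)"
  by (induction k arbitrary: c) auto

lemma Ck_on_add:
  assumes "open S" "Ck_on k S f" "Ck_on k S g"
  shows "Ck_on k S (\<lambda>x. f x + g x)"
  using assms(2,3)
proof (induction k arbitrary: f g)
  case 0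
  then show ?case by (simp add: continuous_on_add)
next
  case (Suc k)
  show ?case
    by (rule Ck_on_SucI[OF assms(1) has_derivative_add])
      (rule Suc.IH Suc.prems Ck_on_Suc_has_derivative Ck_on_frechet_derivative | assumption)+
qed

lemma Ck_on_linear_compose:
  assumes "open S" "bounded_linear L" "Ck_on k S f"
  shows "Ck_on k S (\<lambda>x. L (f x))"
  using assms(3)
proof (induction k arbitrary: f)
  case 0
  then show ?case using assms(2) by (simp add: bounded_linear.continuous_on)
next
  case (Suc k)
  show ?case
    by (rule Ck_on_SucI[OF assms(1) bounded_linear.has_derivative[OF assms(2)]])
      (rule Suc.IH Suc.prems Ck_on_Suc_has_derivative Ck_on_frechet_derivative | assumption)+
qed

text \<open>By the Leibniz rule the derivative is a sum of two terms of the same bilinear form,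
  which the induction hypothesis covers because \<open>f\<close> and \<open>g\<close> are arbitrary
  in it.\<close>

lemma Ck_on_bilinear:
  assumes "open S" "bounded_bilinear h" "Ck_on k S f" "Ck_on k S g"
  shows "Ck_on k S (\<lambda>x. h (f x) (g x))"
  using assms(3,4)
proof (induction k arbitrary: f g)
  case 0
  then show ?case using assms(2) by (simp add: bounded_bilinear.continuous_on)
next
  case (Suc k)
  show ?case
    by (rule Ck_on_SucI[OF assms(1) bounded_bilinear.FDERIV[OF assms(2)]])
      (rule Suc.IH Suc.prems Ck_on_add[OF assms(1)] Ck_on_SucD[OF Suc.prems(1)] Ck_on_SucD[OF Suc.prems(2)]
        Ck_on_Suc_has_derivative Ck_on_frechet_derivative | assumption)+
qed

section \<open>Passage from finite order to smooth maps\<close>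

lemma smooth_on_cong:
  "open S \<Longrightarrow> (\<And>x. x \<in> S \<Longrightarrow> f x = g x) \<Longrightarrow> smooth_on S f \<Longrightarrow> smooth_on S g"
  unfolding smooth_on_def using Ck_on_cong by blast

lemma smooth_on_linear:
  assumes "open S" "bounded_linear L"
  shows "smooth_on S L"
proof -
  have "Ck_on k S L" for k
  proof (cases k)
    case 0
    then show ?thesis using assms(2) by (simp add: linear_continuous_on)
  next
    \<comment> \<open>The derivative of \<open>L\<close> in direction \<open>v\<close> is
      \<open>L v\<close> at every point, a constant, so the recursion stops here.\<close>
    case (Suc j)
    show ?thesis unfolding Suc
      by (rule Ck_on_SucI[OF assms(1) bounded_linear_imp_has_derivative[OF assms(2)] Ck_on_const])
  qed
  then show ?thesis by (simp add: smooth_on_def)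
qed

lemma smooth_on_Pair:
  assumes "open S" "smooth_on S f" "smooth_on S g"
  shows "smooth_on S (\<lambda>x. (f x, g x))"
proof -
  \<comment> \<open>Writing the pair as a sum of two linear embeddings avoids another
    induction.\<close>
  have "Ck_on k S (\<lambda>x. (f x, 0) + (0, g x))" for k
    using assms unfolding smooth_on_def
    by (intro Ck_on_add Ck_on_linear_compose[where L = "\<lambda>y. (y, 0)"]
        Ck_on_linear_compose[where L = "\<lambda>y. (0, y)"] bounded_linear_Pair
        bounded_linear_ident bounded_linear_zero) auto
  then show ?thesis by (simp add: smooth_on_def)
qed

lemma smooth_on_bilinear:
  assumes "open S" "bounded_bilinear h" "smooth_on S f" "smooth_on S g"
  shows "smooth_on S (\<lambda>x. h (f x) (g x))"
  using assms Ck_on_bilinear unfolding smooth_on_def by blast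

lemma smooth_on_add_const:
  assumes "open S" "smooth_on S f"
  shows "smooth_on S (\<lambda>x. f x + c)"
  using assms Ck_on_add Ck_on_const unfolding smooth_on_def by blast

lemma smooth_on_imp_continuous_on: "smooth_on S f \<Longrightarrow> continuous_on S f"
  unfolding smooth_on_def by (metis Ck_on.simps(1))

section \<open>Smoothness of matrix inversion\<close>

text \<open>In finite dimension bilinearity already implies boundedness, so only the algebraic
  identities have to be checked.\<close>

lemma bounded_bilinear_matrix_mult:
  "bounded_bilinear ((**) :: real^'n^'m \<Rightarrow> real^'p^'n \<Rightarrow> real^'p^'m)"
  unfolding bilinear_conv_bounded_bilinear[symmetric] bilinear_def
  by (auto intro!: linearI simp: matrix_matrix_mult_def vec_eq_iff algebra_simps sum.distrib sum_distrib_left)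

lemma matrix_inv_mult:
  fixes A :: "real^'n^'n"
  assumes "A \<in> GL"
  shows "A ** matrix_inv A = mat 1" "matrix_inv A ** A = mat 1"
  using assms someI_ex[of "\<lambda>A'. A ** A' = mat 1 \<and> A' ** A = mat 1"]
  by (auto simp: GL_def invertible_def matrix_inv_def)

text \<open>Column \<open>l\<close> of the inverse solves \<open>A *v x = column l (mat 1)\<close>,
  and Cramer's rule gives its entries as quotients of determinants, visibly continuous in
  \<open>A\<close>.\<close>

lemma matrix_inv_cramer:
  fixes A :: "real^'n^'n"
  assumes "A \<in> GL"
  shows "matrix_inv A = (\<chi> k l. det (\<chi> i j. if j = k then column l (mat 1) $ i else A $ i $ j) / det A)"
proof -
  have "det A \<noteq> 0" using assms by (simp add: GL_def invertible_det_nz)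
  have "column l (matrix_inv A) =
      (\<chi> k. det (\<chi> i j. if j = k then column l (mat 1) $ i else A $ i $ j) / det A)" for l
  proof -
    have "A *v column l (matrix_inv A) = column l (mat 1)"
      using matrix_inv_mult(1)[OF assms]
      by (metis matrix_vector_mult_basis matrix_vector_mul_assoc)
    then show ?thesis using cramer[OF \<open>det A \<noteq> 0\<close>] by blast
  qed
  then have "column l (matrix_inv A) $ k =
      det (\<chi> i j. if j = k then column l (mat 1) $ i else A $ i $ j) / det A" for k l
    by simp
  then show ?thesis by (simp add: vec_eq_iff column_def[of _ "matrix_inv A"])
qed

lemma continuous_on_det:
  fixes f :: "'a::topological_space \<Rightarrow> real^'n^'n"
  assumes "\<And>i j. continuous_on S (\<lambda>x. f x $ i $ j)"
  shows "continuous_on S (\<lambda>x. det (f x))"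
  unfolding det_def by (intro continuous_intros assms)

lemma open_GL: "open (GL :: (real^'n^'n) set)"
proof -
  have "open {A :: real^'n^'n. det A \<noteq> 0}"
    by (intro open_Collect_neq continuous_on_det continuous_intros)
  then show ?thesis by (simp add: GL_def invertible_det_nz)
qed

lemma continuous_on_matrix_inv: "continuous_on GL (matrix_inv :: real^'n^'n \<Rightarrow> real^'n^'n)"
proof -
  \<comment> \<open>The test \<open>j = k\<close> in Cramer's formula does not depend on
    \<open>A\<close>, so each entry is either constant or a coordinate of \<open>A\<close>.\<close>
  have entry: "continuous_on S (\<lambda>A :: real^'n^'n. if P then c else A $ i $ j)" for S P c i j
    by (cases P) (simp_all add: continuous_on_component)
  have "continuous_on GL (\<lambda>A :: real^'n^'n.
      \<chi> k l. det (\<chi> i j. if j = k then column l (mat 1) $ i else A $ i $ j) / det A)"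
    by (intro continuous_on_vec_lambda continuous_on_divide continuous_on_det)
      (simp_all add: entry GL_def invertible_det_nz continuous_on_component)
  then show ?thesis by (simp add: matrix_inv_cramer cong: continuous_on_cong)
qed

lemma has_derivative_matrix_inv:
  fixes A :: "real^'n^'n"
  assumes "A \<in> GL"
  shows "(matrix_inv has_derivative (\<lambda>H. - (matrix_inv A ** H ** matrix_inv A))) (at A)"
proof -
  interpret M: bounded_bilinear "(**) :: real^'n^'n \<Rightarrow> real^'n^'n \<Rightarrow> real^'n^'n"
    by (rule bounded_bilinear_matrix_mult)
  obtain K where K0: "0 \<le> K" and K: "\<And>(A :: real^'n^'n) (B :: real^'n^'n).
      norm (A ** B) \<le> norm A * norm B * K"
    using M.nonneg_bounded by blast
  let ?L = "\<lambda>H. - (matrix_inv A ** H ** matrix_inv A)"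
  \<comment> \<open>Substituting X^-1 - A^-1 = -A^-1 (X - A) X^-1 leaves a remainder with two small
    factors: one cancels the denominator \<open>norm (X - A)\<close>, the other tends to 0 by
    continuity of inversion.\<close>
  have eq: "matrix_inv X - matrix_inv A - ?L (X - A)
      = - (matrix_inv A ** (X - A) ** (matrix_inv X - matrix_inv A))" if "X \<in> GL" for X
    using matrix_inv_mult[OF that] matrix_inv_mult[OF assms]
    by (simp add: M.diff_left M.diff_right matrix_mul_assoc[symmetric])
  have "((\<lambda>X. norm (matrix_inv X - matrix_inv A - ?L (X - A)) / norm (X - A)) \<longlongrightarrow> 0) (at A)"
  proof (rule tendsto_sandwich[OF _ _ tendsto_const])
    show "\<forall>\<^sub>F X in at A. norm (matrix_inv X - matrix_inv A - ?L (X - A)) / norm (X - A)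
        \<le> norm (matrix_inv A) * K * norm (matrix_inv X - matrix_inv A) * K"
      using eventually_at_in_open'[OF open_GL assms]
    proof eventually_elim
      case (elim X)
      let ?d = "matrix_inv X - matrix_inv A"
      have "norm (matrix_inv A ** (X - A) ** ?d) \<le> norm (matrix_inv A ** (X - A)) * norm ?d * K"
        by (rule K)
      also have "\<dots> \<le> (norm (matrix_inv A) * norm (X - A) * K) * norm ?d * K"
        by (intro mult_right_mono K K0 norm_ge_zero)
      also have "\<dots> = (norm (matrix_inv A) * K * norm ?d * K) * norm (X - A)"
        by (simp add: ac_simps)
      \<comment> \<open>The neighbourhood \<open>GL\<close> does not exclude \<open>X = A\<close>;
        there the quotient is 0 by division by zero, and the bound still holds.\<close>
      finally show ?case
        unfolding eq[OF elim] using K0 by (cases "X = A") (simp_all add: divide_le_eq)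
    qed
    have "(matrix_inv \<longlongrightarrow> matrix_inv A) (at A)"
      using continuous_on_matrix_inv[where 'n = 'n] assms
      by (simp add: continuous_on_eq_continuous_at[OF open_GL] continuous_at)
    then have "((\<lambda>X. norm (matrix_inv A) * K * norm (matrix_inv X - matrix_inv A) * K) \<longlongrightarrow>
        norm (matrix_inv A) * K * norm (matrix_inv A - matrix_inv A) * K) (at A)"
      by (intro tendsto_intros)
    then show "((\<lambda>X. norm (matrix_inv A) * K * norm (matrix_inv X - matrix_inv A) * K) \<longlongrightarrow> 0) (at A)"
      by simp
  qed auto
  moreover have "bounded_linear ?L"
    by (intro bounded_linear_minus bounded_linear_compose[OF M.bounded_linear_left M.bounded_linear_right])
  ultimately show ?thesis by (simp only: has_derivative_iff_norm)
qed

text \<open>Stated for composites with \<open>F\<close>, so that no chain rule of order k is needed: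
  in the derivative the inverse reappears undifferentiated, at the order given by the induction
  hypothesis.\<close>

lemma smooth_on_matrix_inv:
  assumes "open S" "smooth_on S F" "F ` S \<subseteq> GL"
  shows "smooth_on S (\<lambda>x. matrix_inv (F x))"
proof -
  have "Ck_on k S (\<lambda>x. matrix_inv (F x))" for k
  proof (induction k)
    case 0
    have "continuous_on S F" using assms(2) unfolding smooth_on_def by (metis Ck_on.simps(1))
    then show ?case using continuous_on_compose2[OF continuous_on_matrix_inv _ assms(3)] by simp
  next
    case (Suc k)
    let ?L = "\<lambda>x v. - (matrix_inv (F x) ** frechet_derivative F (at x) v ** matrix_inv (F x))"
    show ?case
    proof (rule Ck_on_SucI[OF assms(1), where f' = ?L])
      show "((\<lambda>x. matrix_inv (F x)) has_derivative ?L x) (at x)" if "x \<in> S" for x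
        using has_derivative_compose[OF smooth_on_has_derivative[OF assms(2) that] has_derivative_matrix_inv]
          assms(3) that by blast
      have "Ck_on (Suc k) S F" using assms(2) unfolding smooth_on_def by blast
      then show "Ck_on k S (\<lambda>x. ?L x v)" for v
        by (intro Ck_on_linear_compose[OF assms(1), where L = uminus] bounded_linear_minus[OF bounded_linear_ident]
            Ck_on_bilinear[OF assms(1) bounded_bilinear_matrix_mult] Suc) auto
    qed
  qed
  then show ?thesis by (simp add: smooth_on_def)
qed

section \<open>The straightening chart\<close>

text \<open>With the identity as the only chart, compatibility amounts to smoothness of
  \<open>\<phi>\<close> and of its inverse, and \<open>\<psi>\<close> coincides with
  \<open>inv_into U \<phi>\<close> on the image.\<close>

lemma diffeomorphism_in_maximal_atlas:
  assumes "open U" "open (\<phi> ` U)" "smooth_on U \<phi>" "smooth_on (\<phi> ` U) \<psi>"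
    and inv: "\<And>x. x \<in> U \<Longrightarrow> \<psi> (\<phi> x) = x"
  shows "(U, \<phi>) \<in> maximal_atlas \<lparr>mtop = top_of_set U, atlas = {(U, id)}\<rparr>"
proof -
  have inj: "inj_on \<phi> U" using inv by (rule inj_on_inverseI)
  have "homeomorphic_maps (top_of_set U) (top_of_set (\<phi> ` U)) \<phi> \<psi>"
    using assms by (auto simp: homeomorphic_maps_def smooth_on_imp_continuous_on)
  then have "is_chart (top_of_set U) (U, \<phi>)"
    using assms(2) by (auto simp: is_chart_def subtopology_subtopology dest: homeomorphic_maps_imp_map)
  moreover have "smooth_on (\<phi> ` U) (id \<circ> inv_into U \<phi>)"
    by (rule smooth_on_cong[OF assms(2) _ assms(4)]) (auto simp: inv inj)
  moreover have "smooth_on U (\<phi> \<circ> inv_into U id)"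
    by (rule smooth_on_cong[OF assms(1) _ assms(3)]) (simp add: inv_into_f_f[of id U, simplified])
  ultimately show ?thesis by (simp add: maximal_atlas_def compatible_def)
qed

lemma open_subset_smooth_manifold:
  assumes "open (U :: 'e::euclidean_space set)"
  shows "smooth_manifold \<lparr>mtop = top_of_set U, atlas = {(U, id)}\<rparr>"
proof -
  have "smooth_on U id"
    using smooth_on_linear[OF assms bounded_linear_ident] by (simp add: id_def)
  \<comment> \<open>This membership contains both the chart property of the single chart and its
    compatibility with itself.\<close>
  then have "(U, id) \<in> maximal_atlas \<lparr>mtop = top_of_set U, atlas = {(U, id)}\<rparr>"
    using assms by (intro diffeomorphism_in_maximal_atlas[where \<psi> = id]) auto
  moreover have "second_countable (top_of_set U)"
  proof -
    obtain B :: "'e set set" where B: "countable B" "topological_basis B"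
      using ex_countable_basis by blast
    have "\<exists>V\<in>B. x \<in> V \<and> V \<subseteq> W" if "open W" "x \<in> W" for W x
      using topological_basisE[OF B(2) that] by metis
    then have "second_countable (euclidean :: 'e topology)"
      unfolding second_countable_def
      by (intro exI[of _ B]) (simp add: B(1) topological_basis_open[OF B(2)])
    then show ?thesis by (rule second_countable_subtopology)
  qed
  ultimately show ?thesis
    by (simp add: smooth_manifold_def maximal_atlas_def Hausdorff_space_subtopology)
qed

text \<open>Each factor has the single chart \<open>id\<close> on \<open>UNIV \<inter> GL\<close>,
  so the product atlas collapses to one global identity chart.\<close>

lemma G_manifold_eq: "G_manifold = \<lparr>mtop = top_of_set (GL \<times> GL), atlas = {(GL \<times> GL, id)}\<rparr>"
  by (auto simp: G_manifold_def GL_manifold_def product_manifold_def open_submanifold_def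
      euclidean_manifold_def map_prod.id)

section \<open>The straightening map, its inverse and its image\<close>

lemma open_GL_Times_GL: "open (GL \<times> GL :: ((real^'n^'n) \<times> (real^'n^'n)) set)"
  by (intro open_Times open_GL)

text \<open>Subtracting \<open>mat 1\<close> moves the image of \<open>BO\<close> into a slice
  through 0, as the linear \<open>subspace\<close> in \<open>submanifold\<close> requires.\<close>

definition straighten :: "(real^'n^'n) \<times> (real^'n^'n) \<Rightarrow> (real^'n^'n) \<times> (real^'n^'n)" where
  "straighten p = (fst p, fst p ** snd p - mat 1)"

definition unstraighten :: "(real^'n^'n) \<times> (real^'n^'n) \<Rightarrow> (real^'n^'n) \<times> (real^'n^'n)" where
  "unstraighten p = (fst p, matrix_inv (fst p) ** (snd p + mat 1))"

lemma unstraighten_straighten: "fst p \<in> GL \<Longrightarrow> unstraighten (straighten p) = p"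
  by (simp add: straighten_def unstraighten_def matrix_mul_assoc matrix_inv_mult)

text \<open>Solving Z = XY - I gives Y = X^-1 (Z + I), which is invertible exactly when Z + I is.
  The explicit form makes openness of the image evident.\<close>

lemma straighten_image:
  "straighten ` (GL \<times> GL) = {p. fst p \<in> GL \<and> snd p + mat 1 \<in> GL}" (is "_ = ?W")
proof
  show "straighten ` (GL \<times> GL) \<subseteq> ?W"
    by (auto simp: straighten_def GL_def invertible_mult)
next
  have "p = straighten (unstraighten p) \<and> unstraighten p \<in> GL \<times> GL" if "p \<in> ?W" for p
  proof -
    have "matrix_inv (fst p) \<in> GL"
      using that matrix_inv_mult[of "fst p"] by (auto simp: GL_def invertible_def)
    then show ?thesis using that
      by (auto simp: straighten_def unstraighten_def matrix_mul_assoc matrix_inv_mult prod_eq_iff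
          GL_def invertible_mult)
  qed
  then show "?W \<subseteq> straighten ` (GL \<times> GL)" by blast
qed

lemma straighten_chart: "(GL \<times> GL, straighten) \<in> maximal_atlas G_manifold"
  unfolding G_manifold_eq
proof (rule diffeomorphism_in_maximal_atlas[where \<psi> = unstraighten])
  let ?W = "straighten ` (GL \<times> GL) :: ((real^'n^'n) \<times> (real^'n^'n)) set"
  have "open (fst -` GL \<inter> (\<lambda>p. snd p + mat 1) -` GL :: ((real^'n^'n) \<times> (real^'n^'n)) set)"
    by (intro open_Int open_vimage open_GL continuous_intros)
  also have "\<dots> = ?W" unfolding straighten_image by auto
  finally show W: "open ?W" .
  have "smooth_on (GL \<times> GL) (\<lambda>p :: (real^'n^'n) \<times> (real^'n^'n). fst p ** snd p)"
    by (rule smooth_on_bilinear[OF open_GL_Times_GL bounded_bilinear_matrix_mult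
        smooth_on_linear[OF open_GL_Times_GL bounded_linear_fst]
        smooth_on_linear[OF open_GL_Times_GL bounded_linear_snd]])
  from smooth_on_Pair[OF open_GL_Times_GL smooth_on_linear[OF open_GL_Times_GL bounded_linear_fst]
      smooth_on_add_const[OF open_GL_Times_GL this, of "- mat 1"]]
  show "smooth_on (GL \<times> GL) (straighten :: _ \<Rightarrow> (real^'n^'n) \<times> (real^'n^'n))"
    by (simp add: straighten_def[abs_def])
  have "smooth_on ?W (\<lambda>p. matrix_inv (fst p))"
    by (rule smooth_on_matrix_inv[OF W smooth_on_linear[OF W bounded_linear_fst]])
      (auto simp: straighten_def)
  from smooth_on_Pair[OF W smooth_on_linear[OF W bounded_linear_fst]
      smooth_on_bilinear[OF W bounded_bilinear_matrix_mult this
        smooth_on_add_const[OF W smooth_on_linear[OF W bounded_linear_snd], of "mat 1"]]]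
  show "smooth_on ?W unstraighten"
    by (simp add: unstraighten_def[abs_def])
qed (auto simp: open_GL_Times_GL unstraighten_straighten)

theorem lemma1:
  shows "smooth_manifold (G_manifold ::
           ((real ^ 'n ^ 'n) \<times> (real ^ 'n ^ 'n), (real ^ 'n ^ 'n) \<times> (real ^ 'n ^ 'n)) manifold) \<and>
         mdim (G_manifold ::
           ((real ^ 'n ^ 'n) \<times> (real ^ 'n ^ 'n), (real ^ 'n ^ 'n) \<times> (real ^ 'n ^ 'n)) manifold)
           = 2 * CARD('n) ^ 2 \<and>
         submanifold (CARD('n) ^ 2) (BO :: ((real ^ 'n ^ 'n) \<times> (real ^ 'n ^ 'n)) set) G_manifold"
proof (intro conjI)
  show "smooth_manifold (G_manifold :: ((real^'n^'n) \<times> (real^'n^'n), (real^'n^'n) \<times> (real^'n^'n)) manifold)"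
    unfolding G_manifold_eq by (rule open_subset_smooth_manifold[OF open_GL_Times_GL])
  show "mdim (G_manifold :: ((real^'n^'n) \<times> (real^'n^'n), (real^'n^'n) \<times> (real^'n^'n)) manifold)
      = 2 * CARD('n) ^ 2"
    by (simp add: mdim_def power2_eq_square)
  let ?V = "UNIV \<times> {0} :: ((real^'n^'n) \<times> (real^'n^'n)) set"
  have V: "subspace ?V" "dim ?V = CARD('n) ^ 2"
    by (simp_all add: subspace_Times dim_Times power2_eq_square)
  \<comment> \<open>On \<open>GL \<times> GL\<close> the equation XY = I says precisely that the
    second component of \<open>straighten\<close> vanishes.\<close>
  have "straighten ` (GL \<times> GL \<inter> BO) = straighten ` (GL \<times> GL) \<inter> ?V"
    by (auto simp: BO_def straighten_def)
  then have slice: "\<exists>U \<phi> V. (U, \<phi>) \<in> maximal_atlas G_manifold \<and> p \<in> U \<and>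
      subspace V \<and> dim V = CARD('n) ^ 2 \<and> \<phi> ` (U \<inter> BO) = \<phi> ` U \<inter> V"
    if "p \<in> BO" for p :: "(real^'n^'n) \<times> (real^'n^'n)"
    using that straighten_chart V
    by (intro exI[of _ "GL \<times> GL"] exI[of _ straighten] exI[of _ ?V]) (auto simp: BO_def)
  have "BO \<subseteq> topspace (mtop (G_manifold :: ((real^'n^'n) \<times> (real^'n^'n), (real^'n^'n) \<times> (real^'n^'n)) manifold))"
    by (auto simp: G_manifold_eq BO_def)
  then show "submanifold (CARD('n) ^ 2) (BO :: ((real^'n^'n) \<times> (real^'n^'n)) set) G_manifold"
    unfolding submanifold_def by (intro conjI ballI slice)
qed

end
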